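(* For all integers $m,n,m',n'\ge 0$ and all $(z,w)\in\mathbb{C}^2$, $$H_{m,n,m',n'}(z,w)=(-1)^{m+n+m'+n'}e^{|\xi|^2+|\xi^*|^2}A_{\overline{\xi}}^{m}A_{\xi}^{n}A_{\widetilde{\xi}}^{m'}A_{\xi^*}^{n'}\left(e^{-|\xi|^2-|\xi^*|^2}\right).$$
   Context: For integers $m,n\ge 0$ and $\zeta\in\mathbb{C}$, $H_{m,n}(\zeta,\overline{\zeta})=(-1)^{m+n}e^{|\zeta|^2}\frac{\partial^{m+n}}{\partial\overline{\zeta}^{m}\partial\zeta^{n}}\left(e^{-|\zeta|^2}\right)$ (Wirtinger derivatives). For $(z,w)\in\mathbb{C}^2$ set $\xi=z+iw$, $\overline{\xi}=\overline{z}-i\overline{w}$, $\xi^*=\overline{z}+i\overline{w}$, $\widetilde{\xi}=z-iw$ (so $\overline{\xi}$ is the conjugate of $\xi$ and $\widetilde{\xi}$ the conjugate of $\xi^*$), and define $H_{m,n,m',n'}(z,w)=H_{m,n}(\xi,\overline{\xi})\,H_{m',n'}(\xi^*,\widetilde{\xi})$. The first order differential operators on functions on $\mathbb{C}^2$ are $A_{\xi}=\frac12\left(\frac{\partial}{\partial z}-i\frac{\partial}{\partial w}\right)$, $A_{\xi^*}=\frac12\left(\frac{\partial}{\partial\overline{z}}-i\frac{\partial}{\partial\overline{w}}\right)$, $A_{\overline{\xi}}=\frac12\left(\frac{\partial}{\partial\overline{z}}+i\frac{\partial}{\partial\overline{w}}\right)$, $A_{\widetilde{\xi}}=\frac12\left(\frac{\partial}{\partial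 z}+i\frac{\partial}{\partial w}\right)$. *)

theory Defs
  imports "HOL-Analysis.Analysis"
begin

text \<open>
  Functions of a complex variable are differentiated in the real sense: with
  $\zeta = x + i y$, the two partial derivatives are derivatives along the real and the
  imaginary direction, and the Wirtinger derivatives are
  $\frac12(\partial_x - i \partial_y)$ and $\frac12(\partial_x + i \partial_y)$.
\<close>

definition partial_x :: "(complex \<Rightarrow> complex) \<Rightarrow> complex \<Rightarrow> complex" where
  "partial_x f \<zeta> = vector_derivative (\<lambda>t::real. f (\<zeta> + of_real t)) (at 0)"

definition partial_y :: "(complex \<Rightarrow> complex) \<Rightarrow> complex \<Rightarrow> complex" where
  "partial_y f \<zeta> = vector_derivative (\<lambda>t::real. f (\<zeta> + \<i> * of_real t)) (at 0)"

definition wirtinger :: "(complex \<Rightarrow> complex) \<Rightarrow> complex \<Rightarrow> complex" where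
  "wirtinger f \<zeta> = (partial_x f \<zeta> - \<i> * partial_y f \<zeta>) / 2"

definition wirtinger_bar :: "(complex \<Rightarrow> complex) \<Rightarrow> complex \<Rightarrow> complex" where
  "wirtinger_bar f \<zeta> = (partial_x f \<zeta> + \<i> * partial_y f \<zeta>) / 2"

text \<open>
  The complex Hermite polynomial $H_{m,n}(\zeta, \overline{\zeta})$, as a function of $\zeta$
  alone; the second argument is always the conjugate of the first.
\<close>

definition complex_hermite :: "nat \<Rightarrow> nat \<Rightarrow> complex \<Rightarrow> complex" where
  "complex_hermite m n \<zeta> =
     (-1) ^ (m + n) * of_real (exp ((cmod \<zeta>)\<^sup>2)) *
     (wirtinger_bar ^^ m) ((wirtinger ^^ n) (\<lambda>u. of_real (exp (- (cmod u)\<^sup>2)))) \<zeta>"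

definition xi :: "complex \<Rightarrow> complex \<Rightarrow> complex" where
  "xi z w = z + \<i> * w"

definition xi_bar :: "complex \<Rightarrow> complex \<Rightarrow> complex" where
  "xi_bar z w = cnj z - \<i> * cnj w"

definition xi_star :: "complex \<Rightarrow> complex \<Rightarrow> complex" where
  "xi_star z w = cnj z + \<i> * cnj w"

definition xi_tilde :: "complex \<Rightarrow> complex \<Rightarrow> complex" where
  "xi_tilde z w = z - \<i> * w"

lemma cnj_xi: "cnj (xi z w) = xi_bar z w"
  by (simp add: xi_def xi_bar_def)

lemma cnj_xi_star: "cnj (xi_star z w) = xi_tilde z w"
  by (simp add: xi_star_def xi_tilde_def)

text \<open>
  By the two preceding facts this is
  $H_{m,n}(\xi, \overline{\xi}) \, H_{m',n'}(\xi^*, \widetilde{\xi})$.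
\<close>

definition hermite4 :: "nat \<Rightarrow> nat \<Rightarrow> nat \<Rightarrow> nat \<Rightarrow> complex \<Rightarrow> complex \<Rightarrow> complex" where
  "hermite4 m n m' n' z w =
     complex_hermite m n (xi z w) * complex_hermite m' n' (xi_star z w)"

type_synonym fun2 = "complex \<times> complex \<Rightarrow> complex"

definition d_z :: "fun2 \<Rightarrow> fun2" where
  "d_z F = (\<lambda>(z, w). wirtinger (\<lambda>u. F (u, w)) z)"

definition d_zbar :: "fun2 \<Rightarrow> fun2" where
  "d_zbar F = (\<lambda>(z, w). wirtinger_bar (\<lambda>u. F (u, w)) z)"

definition d_w :: "fun2 \<Rightarrow> fun2" where
  "d_w F = (\<lambda>(z, w). wirtinger (\<lambda>v. F (z, v)) w)"

definition d_wbar :: "fun2 \<Rightarrow> fun2" where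
  "d_wbar F = (\<lambda>(z, w). wirtinger_bar (\<lambda>v. F (z, v)) w)"

definition A_xi :: "fun2 \<Rightarrow> fun2" where
  "A_xi F = (\<lambda>p. (d_z F p - \<i> * d_w F p) / 2)"

definition A_xi_star :: "fun2 \<Rightarrow> fun2" where
  "A_xi_star F = (\<lambda>p. (d_zbar F p - \<i> * d_wbar F p) / 2)"

definition A_xi_bar :: "fun2 \<Rightarrow> fun2" where
  "A_xi_bar F = (\<lambda>p. (d_zbar F p + \<i> * d_wbar F p) / 2)"

definition A_xi_tilde :: "fun2 \<Rightarrow> fun2" where
  "A_xi_tilde F = (\<lambda>p. (d_z F p + \<i> * d_w F p) / 2)"

end

theory Submission
  imports Defs
begin

text \<open>
  In the coordinates $(\xi, \xi^*)$ the Gaussian splits as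
  $e^{-|\xi|^2} e^{-|\xi^*|^2}$, and by the chain rule each of the four operators acts on a
  product $f(\xi) g(\xi^*)$ of real-differentiable functions as a single Wirtinger derivative
  of one factor. Iterating this only needs a class of differentiable functions that contains
  the Gaussian and is closed under both Wirtinger derivatives.
\<close>

text \<open>Chain rule along the real line through \<open>\<zeta>\<close> in direction
  \<open>c\<close>. Keeping \<open>c\<close> general lets \<open>c = 1\<close> and
  \<open>c = \<i>\<close> serve the two partial derivatives.\<close>

lemma vector_derivative_along_line:
  fixes f :: "complex \<Rightarrow> complex"
  assumes "(f has_derivative f') (at \<zeta>)"
  shows "vector_derivative (\<lambda>t::real. f (\<zeta> + c * of_real t)) (at 0) = f' c"
proof (rule vector_derivative_at)
  interpret bounded_linear f' by (rule has_derivative_bounded_linear[OF assms])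
  have "((\<lambda>t::real. \<zeta> + c * of_real t) has_derivative (\<lambda>t. c * of_real t)) (at 0)"
    by (auto intro!: derivative_eq_intros)
  then have "((\<lambda>t::real. f (\<zeta> + c * of_real t)) has_derivative (\<lambda>t. f' (c * of_real t))) (at 0)"
    by (rule has_derivative_compose) (use assms in simp)
  \<comment> \<open>\<open>f'\<close> is only real-linear, so the real factor \<open>t\<close> can
    be pulled out of it, but \<open>c\<close> cannot.\<close>
  moreover have "f' (c * of_real t) = t *\<^sub>R f' c" for t
    by (metis scaleR scaleR_conv_of_real mult.commute)
  ultimately show "((\<lambda>t::real. f (\<zeta> + c * of_real t)) has_vector_derivative f' c) (at 0)"
    by (simp add: has_vector_derivative_def)
qed

lemma partial_eqs:
  assumes "(f has_derivative f') (at \<zeta>)"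
  shows "partial_x f \<zeta> = f' 1" "partial_y f \<zeta> = f' \<i>"
  using vector_derivative_along_line[OF assms, of 1] vector_derivative_along_line[OF assms, of \<i>]
  by (simp_all add: partial_x_def partial_y_def)

text \<open>At 1 and \<open>\<i>\<close> the differential takes the values \<open>a + b\<close> and
  \<open>\<i> * (a - b)\<close>; the two Wirtinger combinations solve this system. Every later
  Wirtinger derivative is read off this way.\<close>

lemma wirtinger_eqs:
  assumes "(f has_derivative (\<lambda>h. a * h + b * cnj h)) (at \<zeta>)"
  shows "wirtinger f \<zeta> = a" "wirtinger_bar f \<zeta> = b"
  unfolding wirtinger_def wirtinger_bar_def partial_eqs[OF assms]
  by (simp_all add: field_simps)

text \<open>A real-linear map on the complex plane is determined by its values at 1 and
  \<open>\<i>\<close>, and these are the two partial derivatives.\<close>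

lemma has_derivative_wirtinger:
  fixes f :: "complex \<Rightarrow> complex"
  assumes "f differentiable (at \<zeta>)"
  shows "(f has_derivative (\<lambda>h. wirtinger f \<zeta> * h + wirtinger_bar f \<zeta> * cnj h)) (at \<zeta>)"
proof -
  from assms obtain f' where f': "(f has_derivative f') (at \<zeta>)"
    by (auto simp: differentiable_def)
  interpret bounded_linear f' by (rule has_derivative_bounded_linear[OF f'])
  have "f' h = wirtinger f \<zeta> * h + wirtinger_bar f \<zeta> * cnj h" for h
  proof -
    have h: "h = Re h *\<^sub>R 1 + Im h *\<^sub>R \<i>"
      by (simp add: complex_eq_iff)
    have "f' h = Re h *\<^sub>R f' 1 + Im h *\<^sub>R f' \<i>"
      by (subst h) (simp only: add scaleR)
    then show ?thesis
      unfolding wirtinger_def wirtinger_bar_def partial_eqs[OF f']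
      by (simp add: complex_eq_iff field_simps)
  qed
  then have "f' = (\<lambda>h. wirtinger f \<zeta> * h + wirtinger_bar f \<zeta> * cnj h)" ..
  with f' show ?thesis by simp
qed

text \<open>A function with separated variables in the coordinates \<open>xi\<close>,
  \<open>xi_star\<close>, pulled back to \<open>(z, w)\<close>.\<close>

definition tensor :: "(complex \<Rightarrow> complex) \<Rightarrow> (complex \<Rightarrow> complex) \<Rightarrow> fun2" where
  "tensor f g = (\<lambda>(z, w). f (xi z w) * g (xi_star z w))"

lemma
  assumes f: "\<And>\<zeta>. f differentiable (at \<zeta>)" and g: "\<And>\<zeta>. g differentiable (at \<zeta>)"
  shows A_xi_tensor: "A_xi (tensor f g) = tensor (wirtinger f) g"
    and A_xi_bar_tensor: "A_xi_bar (tensor f g) = tensor (wirtinger_bar f) g"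
    and A_xi_star_tensor: "A_xi_star (tensor f g) = tensor f (wirtinger g)"
    and A_xi_tilde_tensor: "A_xi_tilde (tensor f g) = tensor f (wirtinger_bar g)"
proof -
  \<comment> \<open>The four possible results of differentiating one factor once. Each operator is a
    combination of a \<open>z\<close>- and a \<open>w\<close>-derivative that cancels one of two
    such terms and doubles the other, which the factor 1/2 undoes.\<close>
  define a where "a z w = wirtinger f (xi z w) * g (xi_star z w)" for z w
  define b where "b z w = wirtinger_bar f (xi z w) * g (xi_star z w)" for z w
  define c where "c z w = f (xi z w) * wirtinger g (xi_star z w)" for z w
  define d where "d z w = f (xi z w) * wirtinger_bar g (xi_star z w)" for z w
  note defs = a_def b_def c_def d_def
  \<comment> \<open>An increment \<open>h\<close> of \<open>z\<close> moves \<open>xi_star\<close>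
    by \<open>cnj h\<close>, which swaps the roles of the two Wirtinger derivatives of
    \<open>g\<close>; hence \<open>d\<close> is paired with \<open>a\<close>, and \<open>c\<close>
    with \<open>b\<close>.\<close>
  have "((\<lambda>u. tensor f g (u, w)) has_derivative
      (\<lambda>h. (a z w + d z w) * h + (b z w + c z w) * cnj h)) (at z)" for z w
  proof -
    have "((\<lambda>u. xi u w) has_derivative (\<lambda>h. h)) (at z)"
      "((\<lambda>u. xi_star u w) has_derivative (\<lambda>h. cnj h)) (at z)"
      unfolding xi_def xi_star_def by (auto intro!: derivative_eq_intros)
    from has_derivative_mult[OF
        has_derivative_compose[OF this(1) has_derivative_wirtinger[OF f]]
        has_derivative_compose[OF this(2) has_derivative_wirtinger[OF g]]]
    show ?thesis
      by (simp add: tensor_def defs algebra_simps)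
  qed
  from wirtinger_eqs[OF this]
  have z: "d_z (tensor f g) (z, w) = a z w + d z w"
    "d_zbar (tensor f g) (z, w) = b z w + c z w" for z w
    by (simp_all add: d_z_def d_zbar_def)
  \<comment> \<open>Here the increments are \<open>\<i> * h\<close> and \<open>\<i> * cnj h\<close>.
    The minus signs at \<open>b\<close> and \<open>d\<close> come from conjugating
    \<open>\<i>\<close>.\<close>
  have "((\<lambda>v. tensor f g (z, v)) has_derivative
      (\<lambda>h. (\<i> * (a z w - d z w)) * h + (\<i> * (c z w - b z w)) * cnj h)) (at w)" for z w
  proof -
    have "((\<lambda>v. xi z v) has_derivative (\<lambda>h. \<i> * h)) (at w)"
      "((\<lambda>v. xi_star z v) has_derivative (\<lambda>h. \<i> * cnj h)) (at w)"
      unfolding xi_def xi_star_def by (auto intro!: derivative_eq_intros)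
    from has_derivative_mult[OF
        has_derivative_compose[OF this(1) has_derivative_wirtinger[OF f]]
        has_derivative_compose[OF this(2) has_derivative_wirtinger[OF g]]]
    show ?thesis
      by (simp add: tensor_def defs algebra_simps)
  qed
  from wirtinger_eqs[OF this]
  have w: "d_w (tensor f g) (z, w) = \<i> * (a z w - d z w)"
    "d_wbar (tensor f g) (z, w) = \<i> * (c z w - b z w)" for z w
    by (simp_all add: d_w_def d_wbar_def)
  show "A_xi (tensor f g) = tensor (wirtinger f) g"
    "A_xi_bar (tensor f g) = tensor (wirtinger_bar f) g"
    "A_xi_star (tensor f g) = tensor f (wirtinger g)"
    "A_xi_tilde (tensor f g) = tensor f (wirtinger_bar g)"
    by (auto simp: fun_eq_iff A_xi_def A_xi_bar_def A_xi_star_def A_xi_tilde_def z w)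
      (simp_all add: tensor_def defs algebra_simps)
qed

abbreviation gaussian :: "complex \<Rightarrow> complex" where
  "gaussian \<equiv> \<lambda>u. of_real (exp (- (cmod u)\<^sup>2))"

lemma gaussian_has_derivative:
  "(gaussian has_derivative (\<lambda>h. - (cnj \<zeta> * gaussian \<zeta>) * h + - (\<zeta> * gaussian \<zeta>) * cnj h)) (at \<zeta>)"
proof -
  \<comment> \<open>In this form the product rule and the complex derivative of \<open>exp\<close>
    apply directly.\<close>
  have eq: "of_real (exp (- (cmod u)\<^sup>2)) = exp (- (u * cnj u))" for u
    by (simp add: exp_of_real[symmetric] complex_norm_square[symmetric])
  have "((\<lambda>u. - (u * cnj u)) has_derivative (\<lambda>h. - (\<zeta> * cnj h + h * cnj \<zeta>))) (at \<zeta>)"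
    by (rule derivative_eq_intros refl)+
  moreover have "(exp has_derivative (*) (exp (- (\<zeta> * cnj \<zeta>)))) (at (- (\<zeta> * cnj \<zeta>)))"
    using DERIV_exp by (simp add: has_field_derivative_def)
  ultimately show ?thesis
    unfolding eq
    by (rule has_derivative_compose[THEN has_derivative_eq_rhs])
      (simp add: fun_eq_iff algebra_simps)
qed

text \<open>These are the integer polynomials in \<open>u\<close> and \<open>cnj u\<close> times the
  Gaussian. Generating them inductively replaces computations with coefficients by rule
  induction.\<close>

inductive gaussian_poly :: "(complex \<Rightarrow> complex) \<Rightarrow> bool" where
  gaussian: "gaussian_poly gaussian"
| times: "gaussian_poly f \<Longrightarrow> gaussian_poly (\<lambda>u. u * f u)"
| times_cnj: "gaussian_poly f \<Longrightarrow> gaussian_poly (\<lambda>u. cnj u * f u)"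
| uminus: "gaussian_poly f \<Longrightarrow> gaussian_poly (\<lambda>u. - f u)"
| add: "gaussian_poly f \<Longrightarrow> gaussian_poly g \<Longrightarrow> gaussian_poly (\<lambda>u. f u + g u)"

text \<open>Differentiability alone would not survive iteration, so the induction also keeps both
  coefficients of the differential inside the class.\<close>

lemma gaussian_poly_has_derivative:
  assumes "gaussian_poly f"
  shows "\<exists>a b. gaussian_poly a \<and> gaussian_poly b \<and>
    (\<forall>\<zeta>. (f has_derivative (\<lambda>h. a \<zeta> * h + b \<zeta> * cnj h)) (at \<zeta>))"
  using assms
proof induction
  case gaussian
  show ?case
    by (rule exI[of _ "\<lambda>u. - (cnj u * gaussian u)"], rule exI[of _ "\<lambda>u. - (u * gaussian u)"])
      (intro conjI allI gaussian_has_derivative gaussian_poly.intros)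
next
  case (times f)
  then obtain a b where ab: "gaussian_poly a" "gaussian_poly b"
    and D: "\<And>\<zeta>. (f has_derivative (\<lambda>h. a \<zeta> * h + b \<zeta> * cnj h)) (at \<zeta>)" by blast
  have "((\<lambda>u. u * f u) has_derivative
      (\<lambda>h. (f \<zeta> + \<zeta> * a \<zeta>) * h + (\<zeta> * b \<zeta>) * cnj h)) (at \<zeta>)" for \<zeta>
    by (rule derivative_eq_intros D refl)+ (simp add: fun_eq_iff algebra_simps)
  with ab times.hyps show ?case
    by (intro exI[of _ "\<lambda>u. f u + u * a u"] exI[of _ "\<lambda>u. u * b u"])
      (auto intro: gaussian_poly.intros)
next
  case (times_cnj f)
  then obtain a b where ab: "gaussian_poly a" "gaussian_poly b"
    and D: "\<And>\<zeta>. (f has_derivative (\<lambda>h. a \<zeta> * h + b \<zeta> * cnj h)) (at \<zeta>)" by blast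
  have "((\<lambda>u. cnj u * f u) has_derivative
      (\<lambda>h. (cnj \<zeta> * a \<zeta>) * h + (f \<zeta> + cnj \<zeta> * b \<zeta>) * cnj h)) (at \<zeta>)" for \<zeta>
    by (rule derivative_eq_intros D refl)+ (simp add: fun_eq_iff algebra_simps)
  with ab times_cnj.hyps show ?case
    by (intro exI[of _ "\<lambda>u. cnj u * a u"] exI[of _ "\<lambda>u. f u + cnj u * b u"])
      (auto intro: gaussian_poly.intros)
next
  case (uminus f)
  then obtain a b where ab: "gaussian_poly a" "gaussian_poly b"
    and D: "\<And>\<zeta>. (f has_derivative (\<lambda>h. a \<zeta> * h + b \<zeta> * cnj h)) (at \<zeta>)" by blast
  have "((\<lambda>u. - f u) has_derivative (\<lambda>h. - a \<zeta> * h + - b \<zeta> * cnj h)) (at \<zeta>)" for \<zeta>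
    by (rule derivative_eq_intros D refl)+ (simp add: fun_eq_iff algebra_simps)
  with ab show ?case
    by (intro exI[of _ "\<lambda>u. - a u"] exI[of _ "\<lambda>u. - b u"])
      (auto intro: gaussian_poly.intros)
next
  case (add f g)
  then obtain a b c d where ab: "gaussian_poly a" "gaussian_poly b" "gaussian_poly c" "gaussian_poly d"
    and D: "\<And>\<zeta>. (f has_derivative (\<lambda>h. a \<zeta> * h + b \<zeta> * cnj h)) (at \<zeta>)"
      "\<And>\<zeta>. (g has_derivative (\<lambda>h. c \<zeta> * h + d \<zeta> * cnj h)) (at \<zeta>)" by blast
  have "((\<lambda>u. f u + g u) has_derivative
      (\<lambda>h. (a \<zeta> + c \<zeta>) * h + (b \<zeta> + d \<zeta>) * cnj h)) (at \<zeta>)" for \<zeta>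
    by (rule derivative_eq_intros D refl)+ (simp add: fun_eq_iff algebra_simps)
  with ab show ?case
    by (intro exI[of _ "\<lambda>u. a u + c u"] exI[of _ "\<lambda>u. b u + d u"])
      (auto intro: gaussian_poly.intros)
qed

text \<open>The coefficients \<open>a\<close> and \<open>b\<close> of the differential are the two
  Wirtinger derivatives by \<open>wirtinger_eqs\<close>, so closure under both follows.\<close>

lemma
  assumes "gaussian_poly f"
  shows gaussian_poly_differentiable: "f differentiable (at \<zeta>)"
    and gaussian_poly_wirtinger: "gaussian_poly (wirtinger f)"
    and gaussian_poly_wirtinger_bar: "gaussian_poly (wirtinger_bar f)"
proof -
  obtain a b where ab: "gaussian_poly a" "gaussian_poly b"
    and D: "\<And>\<zeta>. (f has_derivative (\<lambda>h. a \<zeta> * h + b \<zeta> * cnj h)) (at \<zeta>)"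
    using gaussian_poly_has_derivative[OF assms] by blast
  show "f differentiable (at \<zeta>)"
    using D unfolding differentiable_def by blast
  have "wirtinger f = a" "wirtinger_bar f = b"
    using wirtinger_eqs[OF D] by auto
  with ab show "gaussian_poly (wirtinger f)" "gaussian_poly (wirtinger_bar f)"
    by simp_all
qed

lemma gaussian_poly_funpow:
  assumes "gaussian_poly f"
  shows "gaussian_poly ((wirtinger ^^ n) f)" "gaussian_poly ((wirtinger_bar ^^ n) f)"
  using assms
  by (induction n) (auto intro: gaussian_poly_wirtinger gaussian_poly_wirtinger_bar)

text \<open>Each application changes one factor and keeps it in the class, so the differentiability
  needed for the next application is always available.\<close>

lemma
  assumes f: "gaussian_poly f" and g: "gaussian_poly g"
  shows A_xi_funpow_tensor: "(A_xi ^^ n) (tensor f g) = tensor ((wirtinger ^^ n) f) g"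
    and A_xi_bar_funpow_tensor: "(A_xi_bar ^^ n) (tensor f g) = tensor ((wirtinger_bar ^^ n) f) g"
    and A_xi_star_funpow_tensor: "(A_xi_star ^^ n) (tensor f g) = tensor f ((wirtinger ^^ n) g)"
    and A_xi_tilde_funpow_tensor: "(A_xi_tilde ^^ n) (tensor f g) = tensor f ((wirtinger_bar ^^ n) g)"
  using assms
  by (induction n)
    (simp_all add: A_xi_tensor A_xi_bar_tensor A_xi_star_tensor A_xi_tilde_tensor
      gaussian_poly_differentiable gaussian_poly_funpow)

theorem theorem3p5:
  fixes m n m' n' :: nat and z w :: complex
  shows "hermite4 m n m' n' z w =
    (-1) ^ (m + n + m' + n') *
    of_real (exp ((cmod (xi z w))\<^sup>2 + (cmod (xi_star z w))\<^sup>2)) *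
    (A_xi_bar ^^ m) ((A_xi ^^ n) ((A_xi_tilde ^^ m') ((A_xi_star ^^ n')
      (\<lambda>(z, w). of_real (exp (- (cmod (xi z w))\<^sup>2 - (cmod (xi_star z w))\<^sup>2)))))) (z, w)"
proof -
  have "(\<lambda>(z, w). of_real (exp (- (cmod (xi z w))\<^sup>2 - (cmod (xi_star z w))\<^sup>2)))
      = tensor gaussian gaussian"
    by (simp add: tensor_def fun_eq_iff flip: of_real_mult exp_add)
  \<comment> \<open>The powers are evaluated from the inside out: first those acting on the
    \<open>xi_star\<close> factor, then those acting on the \<open>xi\<close> factor. Sign and
    exponential prefactor then split between the two Hermite factors.\<close>
  then show ?thesis
    by (simp add: A_xi_funpow_tensor A_xi_bar_funpow_tensor A_xi_star_funpow_tensor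
        A_xi_tilde_funpow_tensor gaussian_poly_funpow gaussian_poly.gaussian)
      (simp add: tensor_def hermite4_def complex_hermite_def exp_add power_add)
qed

end
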